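(* There is a numerical constant $C>0$ such that the following holds. Let $p\in[1,+\infty)$, $M>0$, and let $W\subset C(\Omega)$ be such that $\|f\|_\infty\le M$ for all $f\in W$. Then for every $m\in\mathbb{N}$ $$er_m(W,L_p)\le C\,p\,m^{-1/2}M^{p-1}\Bigl(M+\sum_{n=0}^m(n+1)^{-1/2}\varepsilon_n(W,L_\infty)\Bigr).$$
   Context: $\Omega$ is a compact subset of $\mathbb{R}^d$, $\mu$ is a (Borel) probability measure on $\Omega$, and $C(\Omega)$ is the space of continuous (real- or complex-valued) functions on $\Omega$. $\|f\|_\infty=\sup_{x\in\Omega}|f(x)|$ is the uniform norm (also denoted $L_\infty$), and $\|f\|_p^p=\int_\Omega|f|^p\,d\mu$. The constant $C$ does not depend on $\Omega,\mu,p,M,W,m$. Discretization numbers: for a class $W\subset C(\Omega)$, $$er_m(W,L_p):=\inf_{\xi^1,\dots,\xi^m\in\Omega}\ \sup_{f\in W}\Bigl|\|f\|_p^p-\frac1m\sum_{j=1}^m|f(\xi^j)|^p\Bigr|.$$ Entropy numbers: for a set $W$ in a normed space $X$ and an integer $k\ge 0$, $$\varepsilon_k(W,X):=\inf\bigl\{\varepsilon>0:\ \exists\, y^1,\dots,y^{2^k}\in W \text{ with } W\subseteq\bigcup_{j=1}^{2^k}B_X(y^j,\varepsilon)\bigr\},\qquad B_X(y,\varepsilon)=\{x\in X:\|x-y\|_X\le\varepsilon\}.$$ $\varepsilon_k(W,L_\infty)$ means the entropy numbers with respect to the uniform norm. *)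

theory Defs
  imports "HOL-Probability.Probability"
begin

text \<open>
  The constant of the theorem must not depend on the dimension \<open>d\<close>, so \<open>d\<close> has to be quantified
  inside the statement. Therefore \<open>\<real>\<^sup>d\<close> is the library space \<^const>\<open>Euclidean_space\<close> \<open>d\<close>, i.e.
  the sequences \<open>x :: nat \<Rightarrow> real\<close> with \<open>x i = 0\<close> for all \<open>i \<ge> d\<close>. Its topology is the subspace
  topology of the type \<open>nat \<Rightarrow> real\<close> (which carries the product topology), so that
  \<^const>\<open>continuous_on\<close> and \<^const>\<open>borel\<close> have their usual meaning on its subsets.

  Elements of \<open>C(\<Omega>)\<close> are represented by total functions that are continuous on \<open>\<Omega>\<close>; nothing
  below depends on their values outside \<open>\<Omega>\<close>.
\<close>

definition unif_norm :: "'a set \<Rightarrow> ('a \<Rightarrow> 'b::real_normed_vector) \<Rightarrow> real" where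
  "unif_norm \<Omega> f = (SUP x\<in>\<Omega>. norm (f x))"

text \<open>The number \<open>\<parallel>f\<parallel>\<^sub>p\<^sup>p\<close>, without taking the \<open>p\<close>-th root.\<close>

definition Lp_norm_pow :: "'a measure \<Rightarrow> real \<Rightarrow> ('a \<Rightarrow> 'b::real_normed_vector) \<Rightarrow> real" where
  "Lp_norm_pow \<mu> p f = (LINT x|\<mu>. norm (f x) powr p)"

text \<open>
  The infima and suprema below are taken in \<^typ>\<open>ennreal\<close>, so that they have their usual values
  also for empty or unbounded sets.
\<close>

definition discretization_number ::
    "'a set \<Rightarrow> 'a measure \<Rightarrow> nat \<Rightarrow> ('a \<Rightarrow> 'b::real_normed_vector) set \<Rightarrow> real \<Rightarrow> ennreal" where
  "discretization_number \<Omega> \<mu> m W p =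
     (INF \<xi> \<in> {1..m} \<rightarrow> \<Omega>. SUP f\<in>W.
        ennreal \<bar>Lp_norm_pow \<mu> p f - 1 / real m * (\<Sum>j=1..m. norm (f (\<xi> j)) powr p)\<bar>)"

text \<open>
  The norm is an explicit argument \<open>nrm\<close>, since \<open>C(\<Omega>)\<close> is not a type of class
  \<^class>\<open>real_normed_vector\<close>. The points \<open>y j\<close> need not be distinct.
\<close>

definition entropy_number :: "('v::minus \<Rightarrow> real) \<Rightarrow> nat \<Rightarrow> 'v set \<Rightarrow> ennreal" where
  "entropy_number nrm k W =
     Inf {ennreal \<epsilon> |\<epsilon>. \<epsilon> > 0 \<and>
       (\<exists>y. (\<forall>j\<in>{1..2 ^ k :: nat}. y j \<in> W) \<and>
            W \<subseteq> (\<Union>j\<in>{1..2 ^ k}. {x. nrm (x - y j) \<le> \<epsilon>}))}"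

end

theory Submission
  imports Defs
begin

text \<open>
  The nodes \<open>\<xi>\<close> are found by the probabilistic method: for \<open>m\<close> independent points with
  distribution \<open>\<mu>\<close>, the bound holds with positive probability. Write \<open>\<phi> f = \<bar>f\<bar>\<^sup>p\<close> and let \<open>E f\<close> be the
  difference between the mean of \<open>\<phi> f\<close> and its average over the nodes. On values in \<open>[0, M]\<close> the
  power \<open>t\<^sup>p\<close> is Lipschitz with constant \<open>L = p M\<^sup>p\<^sup>-\<^sup>1\<close> (\<open>powr_Lipschitz\<close>), so \<open>\<phi>\<close> maps an
  \<open>\<epsilon>\<close>-net of \<open>W\<close> to an \<open>L \<epsilon>\<close>-net of its image; this is where the factor \<open>p M\<^sup>p\<^sup>-\<^sup>1\<close> comes from.

  The supremum over \<open>W\<close> is controlled by Dudley's chaining. Let \<open>Y n\<close> be a net of at most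
  \<open>2\<^sup>n\<close> elements of \<open>W\<close> with radius \<open>e n\<close> slightly above \<open>\<epsilon>\<^sub>n(W)\<close>. Every element of \<open>Y n\<close>
  has a parent in \<open>Y (n div 2)\<close> at distance at most \<open>e (n div 2)\<close>, because the nets lie in
  \<open>W\<close>. By Hoeffding's inequality, the errors of an element of \<open>Y n\<close> and of its parent differ by more than
  \<open>2 L e (n div 2) sqrt ((n + 1) / m)\<close> with probability at most \<open>2 exp (-2 (n + 1))\<close>, while there
  are only \<open>2\<^sup>n\<close> such pairs. The total failure probability over all \<open>n \<le> m\<close> is therefore below 1
  (\<open>link_failure_probability_less_1\<close>), and some \<open>\<xi>\<close> makes all these estimates true at once
  (\<open>simultaneous_sampling\<close>).

  For such a \<open>\<xi>\<close> the rest is deterministic. Following the parents from \<open>f \<in> Y m\<close> down to \<open>Y 0\<close>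
  adds up the terms \<open>sqrt (n + 1) e (n div 2)\<close> along \<open>n = m, m div 2, m div 4, \<dots>\<close>; as \<open>e\<close> is
  decreasing, each of them is dominated by a dyadic block of \<open>\<Sum> e j / sqrt (j + 1)\<close>
  (\<open>dyadic_block_le\<close>, \<open>chaining\<close>). Replacing an arbitrary \<open>f \<in> W\<close> by its neighbour in \<open>Y m\<close>
  costs at most \<open>2 L e m\<close>, which the same sum controls since it has \<open>m + 1\<close> terms, each at least
  \<open>e m / sqrt (m + 1)\<close> (\<open>sum_sqrt_weights_ge\<close>).
\<close>

section \<open>Sampling errors of random nodes\<close>

definition sampling_error :: "'a measure \<Rightarrow> nat \<Rightarrow> ('a \<Rightarrow> real) \<Rightarrow> (nat \<Rightarrow> 'a) \<Rightarrow> real" where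
  "sampling_error \<mu> m h \<xi> = (LINT x|\<mu>. h x) - 1 / real m * (\<Sum>j=1..m. h (\<xi> j))"

lemma sampling_error_diff:
  assumes "integrable \<mu> g" "integrable \<mu> h"
  shows "sampling_error \<mu> m (\<lambda>x. g x - h x) \<xi> = sampling_error \<mu> m g \<xi> - sampling_error \<mu> m h \<xi>"
  using assms by (simp add: sampling_error_def sum_subtractf algebra_simps)

lemma abs_sampling_error_le:
  assumes "prob_space \<mu>" "h \<in> borel_measurable \<mu>" "\<And>x. x \<in> space \<mu> \<Longrightarrow> \<bar>h x\<bar> \<le> c"
    and "\<xi> \<in> {1..m} \<rightarrow> space \<mu>" "m \<ge> 1"
  shows "\<bar>sampling_error \<mu> m h \<xi>\<bar> \<le> 2 * c"
proof -
  interpret prob_space \<mu> by fact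
  have int: "integrable \<mu> h"
    by (rule integrable_const_bound[where B = c]) (use assms in auto)
  have "\<bar>LINT x|\<mu>. h x\<bar> \<le> (LINT x|\<mu>. \<bar>h x\<bar>)"
    by (rule integral_abs_bound)
  also have "\<dots> \<le> (LINT x|\<mu>. c)"
    by (rule integral_mono) (use int assms in auto)
  finally have 1: "\<bar>LINT x|\<mu>. h x\<bar> \<le> c"
    by (simp add: prob_space)
  have "\<bar>\<Sum>j=1..m. h (\<xi> j)\<bar> \<le> (\<Sum>j=1..m. \<bar>h (\<xi> j)\<bar>)"
    by (rule sum_abs)
  also have "\<dots> \<le> (\<Sum>j=1..m. c)"
    by (rule sum_mono) (use assms in \<open>auto simp: Pi_iff\<close>)
  finally have "\<bar>1 / real m * (\<Sum>j=1..m. h (\<xi> j))\<bar> \<le> c"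
    using \<open>m \<ge> 1\<close> by (simp add: abs_mult field_simps)
  with 1 show ?thesis
    unfolding sampling_error_def by linarith
qed

lemma indep_vars_PiM_coordinates:
  assumes M: "\<And>i. i \<in> I \<Longrightarrow> prob_space (M i)" and "I \<noteq> {}"
  shows "prob_space.indep_vars (PiM I M) M (\<lambda>i \<omega>. \<omega> i) I"
proof -
  interpret P: prob_space "PiM I M"
    using M by (rule prob_space_PiM)
  have "distr (PiM I M) (PiM I M) (\<lambda>x. \<lambda>i\<in>I. x i) = distr (PiM I M) (PiM I M) (\<lambda>x. x)"
    by (rule distr_cong) (auto simp: space_PiM)
  also have "\<dots> = (\<Pi>\<^sub>M i\<in>I. distr (PiM I M) (M i) (\<lambda>\<omega>. \<omega> i))"
    by (subst distr_id2) (auto intro!: PiM_cong distr_PiM_component[symmetric] M)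
  finally show ?thesis
    using \<open>I \<noteq> {}\<close> by (subst P.indep_vars_iff_distr_eq_PiM') auto
qed

text \<open>
  The values of \<open>h\<close> at the nodes are i.i.d. random variables on the product space with values in an
  interval of length \<open>2 \<delta>\<close>, so this is Hoeffding's inequality; the deviation is measured in units of
  \<open>\<delta> / sqrt m\<close> so that \<open>m\<close> and \<open>\<delta>\<close> disappear from the tail bound.
\<close>
lemma Hoeffding_sampling_error:
  assumes "prob_space \<mu>" and h[measurable]: "h \<in> borel_measurable \<mu>"
    and bound: "\<And>x. x \<in> space \<mu> \<Longrightarrow> \<bar>h x\<bar> \<le> \<delta>" and "\<delta> > 0" "s \<ge> 0" "m \<ge> 1"
  shows "measure (\<Pi>\<^sub>M j\<in>{1..m}. \<mu>)
           {\<xi> \<in> space (\<Pi>\<^sub>M j\<in>{1..m}. \<mu>). \<bar>sampling_error \<mu> m h \<xi>\<bar> \<ge> s * \<delta> / sqrt m} \<le> 2 * exp (- s\<^sup>2 / 2)"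
proof -
  interpret prob_space \<mu> by fact
  let ?P = "\<Pi>\<^sub>M j\<in>{1..m}. \<mu>"
  interpret P: prob_space ?P
    by (rule prob_space_PiM) (rule \<open>prob_space \<mu>\<close>)
  have distr: "distr ?P borel (\<lambda>\<xi>. h (\<xi> j)) = distr \<mu> borel h" if "j \<in> {1..m}" for j
  proof -
    have "distr ?P borel (\<lambda>\<xi>. h (\<xi> j)) = distr (distr ?P \<mu> (\<lambda>\<xi>. \<xi> j)) borel h"
      using that by (subst distr_distr) (auto simp: comp_def)
    also have "distr ?P \<mu> (\<lambda>\<xi>. \<xi> j) = \<mu>"
      using that by (intro distr_PiM_component) (auto intro: prob_space_axioms)
    finally show ?thesis .
  qed
  have 1: "1 \<in> {1..m}"
    using \<open>m \<ge> 1\<close> by simp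
  have meas1[measurable]: "(\<lambda>\<xi>. h (\<xi> 1)) \<in> borel_measurable ?P"
    by (rule measurable_compose[OF measurable_component_singleton[OF 1] h])
  have expect: "P.expectation (\<lambda>\<xi>. h (\<xi> 1)) = expectation h"
  proof -
    have "P.expectation (\<lambda>\<xi>. h (\<xi> 1)) = (LINT x|distr ?P borel (\<lambda>\<xi>. h (\<xi> 1)). x)"
      by (subst integral_distr[OF meas1]) simp_all
    also have "\<dots> = expectation h"
      unfolding distr[OF 1] by (subst integral_distr) auto
    finally show ?thesis .
  qed
  interpret Hoeffding_ineq_iid ?P "{1..m}" "\<lambda>j \<xi>. h (\<xi> j)" "\<lambda>\<xi>. h (\<xi> 1)" "-\<delta>" \<delta>
    "P.expectation (\<lambda>\<xi>. h (\<xi> 1))"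
  proof unfold_locales
    show "P.indep_vars (\<lambda>_. borel) (\<lambda>j \<xi>. h (\<xi> j)) {1..m}"
      using 1 by (intro P.indep_vars_compose2[OF indep_vars_PiM_coordinates])
        (auto intro: prob_space_axioms)
    show "AE \<xi> in ?P. h (\<xi> 1) \<in> {-\<delta>..\<delta>}"
    proof (rule AE_I2)
      fix \<xi> assume "\<xi> \<in> space ?P"
      then have "\<xi> 1 \<in> space \<mu>"
        using 1 by (auto simp: space_PiM)
      from bound[OF this] show "h (\<xi> 1) \<in> {-\<delta>..\<delta>}"
        by auto
    qed
    show "distr ?P borel (\<lambda>\<xi>. h (\<xi> j)) = distr ?P borel (\<lambda>\<xi>. h (\<xi> 1))" if "j \<in> {1..m}" for j
      by (simp only: distr[OF that] distr[OF 1])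
  qed (fact finite_atLeastAtMost meas1)+
  have "{\<xi> \<in> space ?P. \<bar>sampling_error \<mu> m h \<xi>\<bar> \<ge> s * \<delta> / sqrt m} =
    {\<xi> \<in> space ?P. \<bar>(\<Sum>j\<in>{1..m}. h (\<xi> j)) / card {1..m} - P.expectation (\<lambda>\<xi>. h (\<xi> 1))\<bar> \<ge> s * \<delta> / sqrt m}"
    unfolding expect by (auto simp: sampling_error_def abs_minus_commute)
  also have "P.prob \<dots> \<le> 2 * exp (-2 * real (card {1..m}) * (s * \<delta> / sqrt m)\<^sup>2 / (\<delta> - (-\<delta>))\<^sup>2)"
    using assms 1 by (intro Hoeffding_ineq_abs_ge') auto
  also have "-2 * real (card {1..m}) * (s * \<delta> / sqrt m)\<^sup>2 / (\<delta> - (-\<delta>))\<^sup>2 = - s\<^sup>2 / 2"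
    using \<open>m \<ge> 1\<close> \<open>\<delta> > 0\<close> by (simp add: power_divide power_mult_distrib field_simps)
  finally show ?thesis .
qed

text \<open>
  Union bound: if the tail probabilities sum to less than 1, the exceptional events do not cover the
  sample space.
\<close>
lemma simultaneous_sampling:
  assumes "prob_space \<mu>" "finite I" "m \<ge> 1"
    and h[measurable]: "\<And>i. i \<in> I \<Longrightarrow> h i \<in> borel_measurable \<mu>"
    and bound: "\<And>i x. i \<in> I \<Longrightarrow> x \<in> space \<mu> \<Longrightarrow> \<bar>h i x\<bar> \<le> \<delta> i"
    and pos: "\<And>i. i \<in> I \<Longrightarrow> \<delta> i > 0" "\<And>i. i \<in> I \<Longrightarrow> s i \<ge> 0"
    and small: "(\<Sum>i\<in>I. 2 * exp (- (s i)\<^sup>2 / 2)) < 1"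
  obtains \<xi> where "\<xi> \<in> {1..m} \<rightarrow> space \<mu>"
    "\<And>i. i \<in> I \<Longrightarrow> \<bar>sampling_error \<mu> m (h i) \<xi>\<bar> \<le> s i * \<delta> i / sqrt m"
proof -
  let ?P = "\<Pi>\<^sub>M j\<in>{1..m}. \<mu>"
  interpret P: prob_space ?P
    by (rule prob_space_PiM) (rule \<open>prob_space \<mu>\<close>)
  define B where "B i = {\<xi> \<in> space ?P. \<bar>sampling_error \<mu> m (h i) \<xi>\<bar> \<ge> s i * \<delta> i / sqrt m}" for i
  have B: "B i \<in> sets ?P" if [simp]: "i \<in> I" for i
    unfolding B_def sampling_error_def by measurable
  have "P.prob (\<Union>i\<in>I. B i) \<le> (\<Sum>i\<in>I. P.prob (B i))"
    using B by (intro P.finite_measure_subadditive_finite \<open>finite I\<close>) auto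
  also have "\<dots> \<le> (\<Sum>i\<in>I. 2 * exp (- (s i)\<^sup>2 / 2))"
    unfolding B_def using assms by (intro sum_mono Hoeffding_sampling_error) auto
  also have "\<dots> < P.prob (space ?P)"
    using small by (simp only: P.prob_space)
  finally have "\<not> space ?P \<subseteq> (\<Union>i\<in>I. B i)"
    using P.finite_measure_mono[of "space ?P" "\<Union>i\<in>I. B i"] B \<open>finite I\<close> by fastforce
  then obtain \<xi> where "\<xi> \<in> space ?P" "\<And>i. i \<in> I \<Longrightarrow> \<xi> \<notin> B i"
    by auto
  then show ?thesis
    by (intro that[of \<xi>]) (force simp: B_def space_PiM)+
qed

section \<open>Lipschitz continuity of powers\<close>

lemma powr_Lipschitz:
  fixes a b p M :: real
  assumes "0 \<le> a" "0 \<le> b" "a \<le> M" "b \<le> M" "p \<ge> 1"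
  shows "\<bar>a powr p - b powr p\<bar> \<le> p * M powr (p - 1) * \<bar>a - b\<bar>"
proof -
  have *: "b powr p - a powr p \<le> p * M powr (p - 1) * (b - a)" if ab: "0 \<le> a" "a < b" "b \<le> M" for a b
  proof -
    obtain z where z: "a < z" "z < b" "b powr p - a powr p = p * z powr (p - 1) * (b - a)"
    proof (rule mvt)
      show "continuous_on {a..b} (\<lambda>x. x powr p)"
        using ab \<open>p \<ge> 1\<close> by (intro continuous_on_powr') (auto intro!: continuous_intros)
      show "((\<lambda>x. x powr p) has_derivative (\<lambda>d. p * x powr (p - 1) * d)) (at x)"
        if "a < x" "x < b" for x
        using that ab has_real_derivative_powr[of x p] by (simp add: has_field_derivative_def)
    qed (use ab in auto)
    have "z powr (p - 1) \<le> M powr (p - 1)"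
      using z ab \<open>p \<ge> 1\<close> by (intro powr_mono2) auto
    with z ab \<open>p \<ge> 1\<close> show ?thesis
      by (auto simp: mult_ac intro!: mult_left_mono)
  qed
  have mono: "x powr p \<le> y powr p" if "0 \<le> x" "x \<le> y" for x y
    using that \<open>p \<ge> 1\<close> by (intro powr_mono2) auto
  show ?thesis
    using *[of a b] *[of b a] mono[of a b] mono[of b a] assms
    by (cases a b rule: linorder_cases) auto
qed

section \<open>Entropy numbers and nets\<close>

lemma antimono_entropy_number: "antimono (\<lambda>k. entropy_number nrm k W)"
proof (rule antimonoI)
  fix k l :: nat assume "k \<le> l"
  define net where "net n \<epsilon> \<longleftrightarrow>
    (\<exists>y. (\<forall>j\<in>{1..2 ^ n :: nat}. y j \<in> W) \<and> W \<subseteq> (\<Union>j\<in>{1..2 ^ n}. {x. nrm (x - y j) \<le> \<epsilon>}))"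
    for n :: nat and \<epsilon> :: real
  have *: "net l \<epsilon>" if "net k \<epsilon>" for \<epsilon>
  proof -
    from that obtain y where y: "\<forall>j\<in>{1..2 ^ k :: nat}. y j \<in> W"
      "W \<subseteq> (\<Union>j\<in>{1..2 ^ k}. {x. nrm (x - y j) \<le> \<epsilon>})"
      unfolding net_def by blast
    have kl: "(2::nat) ^ k \<le> 2 ^ l"
      using \<open>k \<le> l\<close> by simp
    \<comment> \<open>The finer family of centres repeats the last of the \<open>2 ^ k\<close> given ones.\<close>
    have "W \<subseteq> (\<Union>j\<in>{1..2 ^ l}. {x. nrm (x - y (min j (2 ^ k))) \<le> \<epsilon>})"
    proof
      fix x assume "x \<in> W"
      then obtain j where "j \<in> {1..2 ^ k}" "nrm (x - y j) \<le> \<epsilon>"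
        using y(2) by blast
      moreover from this have "j \<in> {1..2 ^ l}" "min j (2 ^ k) = j"
        using order_trans[OF _ kl] by auto
      ultimately show "x \<in> (\<Union>j\<in>{1..2 ^ l}. {x. nrm (x - y (min j (2 ^ k))) \<le> \<epsilon>})"
        by (intro UN_I[of j]) simp_all
    qed
    moreover have "\<forall>j\<in>{1..2 ^ l}. y (min j (2 ^ k)) \<in> W"
      using y(1) by auto
    ultimately show "net l \<epsilon>"
      unfolding net_def by (intro exI[of _ "\<lambda>j. y (min j (2 ^ k))"] conjI)
  qed
  show "entropy_number nrm l W \<le> entropy_number nrm k W"
    unfolding entropy_number_def net_def[symmetric] by (intro Inf_superset_mono) (use * in blast)
qed

text \<open>
  The infimum defining an entropy number need not be attained, hence the strict inequality.
\<close>
lemma entropy_number_net: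
  assumes "entropy_number nrm k W < ennreal r"
  obtains Y where "Y \<subseteq> W" "finite Y" "card Y \<le> 2 ^ k" "\<And>f. f \<in> W \<Longrightarrow> \<exists>g\<in>Y. nrm (f - g) \<le> r"
proof -
  from assms obtain \<epsilon> y where \<epsilon>: "ennreal \<epsilon> < ennreal r"
    and y: "\<forall>j\<in>{1..2 ^ k :: nat}. y j \<in> W" "W \<subseteq> (\<Union>j\<in>{1..2 ^ k}. {x. nrm (x - y j) \<le> \<epsilon>})"
    unfolding entropy_number_def Inf_less_iff by blast
  have "\<epsilon> \<le> r"
    using \<epsilon> by (meson ennreal_leI leD le_cases)
  show ?thesis
  proof (rule that[of "y ` {1..2 ^ k}"])
    show "card (y ` {1..2 ^ k}) \<le> 2 ^ k"
      using card_image_le[of "{1..2 ^ k :: nat}" y] by simp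
    show "\<exists>g\<in>y ` {1..2 ^ k}. nrm (f - g) \<le> r" if "f \<in> W" for f
    proof -
      from y(2) that obtain j where "j \<in> {1..2 ^ k}" "nrm (f - y j) \<le> \<epsilon>"
        by blast
      with \<open>\<epsilon> \<le> r\<close> show ?thesis
        by (intro bexI[of _ "y j"]) auto
    qed
  qed (use y(1) in auto)
qed

lemma entropy_number_le:
  assumes "f \<in> W" "\<And>g. g \<in> W \<Longrightarrow> nrm (g - f) \<le> r" "r > 0"
  shows "entropy_number nrm k W \<le> ennreal r"
  unfolding entropy_number_def
proof (rule Inf_lower, intro CollectI exI conjI)
  show "W \<subseteq> (\<Union>j\<in>{1..2 ^ k :: nat}. {x. nrm (x - f) \<le> r})"
    using assms(2) by auto
qed (use assms in auto)

section \<open>Chaining\<close>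

text \<open>
  The block \<open>k div 2 < j \<le> k\<close> has at least \<open>k / 2\<close> terms, and each is at least
  \<open>e k / sqrt (k + 1)\<close>. Hence the block sum is at least of order \<open>sqrt k e k\<close>, and \<open>n \<le> 2 k + 1\<close>. The
  constant 6 absorbs the roundings.
\<close>
lemma dyadic_block_le:
  fixes e :: "nat \<Rightarrow> real"
  assumes "antimono e" "\<And>j. e j \<ge> 0" and k: "k = n div 2" "k \<ge> 1"
  shows "sqrt (real n + 1) * e k \<le> 6 * (\<Sum>j=k div 2 + 1..k. e j / sqrt (real j + 1))"
proof -
  have "sqrt (real n + 1) * sqrt (real k + 1) \<le> sqrt ((3 * real k)\<^sup>2)"
  proof -
    have "real n \<le> 2 * real k + 1"
      using k by linarith
    then have "(real n + 1) * (real k + 1) \<le> (4 * real k) * (2 * real k)"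
      using k by (intro mult_mono) auto
    also have "\<dots> \<le> (3 * real k)\<^sup>2"
      by (simp add: power2_eq_square)
    finally show ?thesis
      unfolding real_sqrt_mult[symmetric] by (rule real_sqrt_le_mono)
  qed
  also have "\<dots> = 3 * real k"
    by (subst real_sqrt_abs) simp
  also have "\<dots> \<le> 6 * (real k - real (k div 2))"
  proof -
    have "2 * (k div 2) \<le> k"
      by simp
    then have "2 * real (k div 2) \<le> real k"
      by linarith
    then show ?thesis
      by simp
  qed
  finally have "sqrt (real n + 1) \<le> 6 * (real k - real (k div 2)) / sqrt (real k + 1)"
    by (simp add: field_simps)
  then have "sqrt (real n + 1) * e k \<le> 6 * (real k - real (k div 2)) / sqrt (real k + 1) * e k"
    using assms by (intro mult_right_mono) auto
  also have "\<dots> = 6 * (\<Sum>j=k div 2 + 1..k. e k / sqrt (real k + 1))"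
    by (simp add: of_nat_diff)
  also have "\<dots> \<le> 6 * (\<Sum>j=k div 2 + 1..k. e j / sqrt (real j + 1))"
    using assms(2) by (intro mult_left_mono sum_mono frac_le) (auto intro: antimonoD[OF assms(1)])
  finally show ?thesis .
qed

text \<open>
  Halving \<open>n\<close> in each link keeps the blocks of consecutive links disjoint, so that their sums
  add up to a single sum. It ends at \<open>n div 2\<close> because the block belonging to the link from \<open>n\<close>
  to \<open>n div 2\<close> ends there; the smaller upper limit is what makes the induction work.
\<close>
lemma chaining:
  fixes E :: "'v \<Rightarrow> real" and Y :: "nat \<Rightarrow> 'v set"
  assumes e: "antimono e" "\<And>j. e j \<ge> 0" and "a \<ge> 0"
    and root: "\<And>f. f \<in> Y 0 \<Longrightarrow> \<bar>E f\<bar> \<le> a * M"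
    and link: "\<And>n f. 1 \<le> n \<Longrightarrow> n \<le> m \<Longrightarrow> f \<in> Y n \<Longrightarrow>
      \<exists>g\<in>Y (n div 2). \<bar>E f - E g\<bar> \<le> a * (sqrt (real n + 1) * e (n div 2))"
    and "n \<le> m" "f \<in> Y n"
  shows "\<bar>E f\<bar> \<le> a * (M + 6 * (\<Sum>j\<le>n div 2. e j / sqrt (real j + 1)))"
  using \<open>n \<le> m\<close> \<open>f \<in> Y n\<close>
proof (induction n arbitrary: f rule: less_induct)
  case (less n)
  define S where "S k = (\<Sum>j\<le>k. e j / sqrt (real j + 1))" for k :: nat
  show ?case
  proof (cases "n = 0")
    case True
    have "a * M \<le> a * (M + 6 * S 0)"
      using e \<open>a \<ge> 0\<close> by (intro mult_left_mono) (auto simp: S_def)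
    with root[of f] less.prems True show ?thesis
      by (simp add: S_def)
  next
    case False
    define k where "k = n div 2"
    obtain g where g: "g \<in> Y k" "\<bar>E f - E g\<bar> \<le> a * (sqrt (real n + 1) * e k)"
      using link[of n f] less.prems False unfolding k_def by auto
    have step: "M' + sqrt (real n + 1) * e k \<le> M + 6 * S k"
      if "M' = (if k = 0 then M else M + 6 * S (k div 2))" for M'
    proof (cases "k = 0")
      case True
      then have "n = 1"
        using False by (simp add: k_def)
      have "sqrt 2 \<le> sqrt (6\<^sup>2)"
        by (intro real_sqrt_le_mono) simp
      then have "sqrt 2 * e 0 \<le> 6 * e 0"
        using e by (intro mult_right_mono) auto
      then show ?thesis
        using that True \<open>n = 1\<close> by (simp add: S_def)
    next
      case False
      have "{..k} = {..k div 2} \<union> {k div 2 + 1..k}"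
        by auto
      then have "S k = S (k div 2) + (\<Sum>j=k div 2 + 1..k. e j / sqrt (real j + 1))"
        unfolding S_def by (simp add: sum.union_disjoint)
      moreover have "sqrt (real n + 1) * e k \<le> 6 * (\<Sum>j=k div 2 + 1..k. e j / sqrt (real j + 1))"
        using dyadic_block_le[OF e k_def] False by simp
      ultimately show ?thesis
        using that False by simp
    qed
    have "k < n" "k \<le> m"
      using False less.prems by (auto simp: k_def)
    then have "\<bar>E g\<bar> \<le> a * (if k = 0 then M else M + 6 * S (k div 2))"
      using less.IH[of k g] root[of g] g by (cases "k = 0") (simp_all add: S_def)
    with g(2) have "\<bar>E f\<bar> \<le> a * ((if k = 0 then M else M + 6 * S (k div 2)) + sqrt (real n + 1) * e k)"
      unfolding distrib_left by linarith
    also have "\<dots> \<le> a * (M + 6 * S k)"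
      using \<open>a \<ge> 0\<close> step by (intro mult_left_mono) auto
    finally show ?thesis
      by (simp add: S_def k_def)
  qed
qed

text \<open>
  Since \<open>2 exp (-2) \<le> 1 / 2\<close>, the \<open>2\<^sup>n\<close> links of level \<open>n\<close> contribute at most \<open>(1 / 2)\<^sup>n\<^sup>+\<^sup>1\<close>.
\<close>
lemma link_failure_probability_less_1:
  fixes Y :: "nat \<Rightarrow> 'v set"
  assumes "\<And>n. finite (Y n)" "\<And>n. card (Y n) \<le> 2 ^ n"
  shows "(\<Sum>(n, f)\<in>Sigma {..m} Y. 2 * exp (- (2 * sqrt (real n + 1))\<^sup>2 / 2)) < 1"
proof -
  have "(1 + 1 :: real) \<le> exp 1"
    by (rule exp_ge_add_one_self)
  then have "(2::real) * 2 \<le> exp 1 * exp 1"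
    by (intro mult_mono) auto
  then have exp2: "exp (-2) \<le> (1 / 4 :: real)"
    by (simp add: exp_minus field_simps flip: exp_add)
  have eq: "2 * exp (- (2 * sqrt (real n + 1))\<^sup>2 / 2) = 2 * exp (-2) ^ Suc n" for n
  proof -
    have "- (2 * sqrt (real n + 1))\<^sup>2 / 2 = real (Suc n) * (- 2)"
      by (simp add: power_mult_distrib)
    then show ?thesis
      by (simp only: exp_of_nat_mult)
  qed
  have "(\<Sum>(n, f)\<in>Sigma {..m} Y. 2 * exp (- (2 * sqrt (real n + 1))\<^sup>2 / 2)) =
      (\<Sum>n\<le>m. real (card (Y n)) * (2 * exp (-2) ^ Suc n))"
    unfolding eq using assms(1) by (subst sum.Sigma[symmetric]) auto
  also have "\<dots> \<le> (\<Sum>n\<le>m. 2 ^ n * (2 * (1 / 4) ^ Suc n))"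
  proof (intro sum_mono mult_mono)
    fix n
    show "real (card (Y n)) \<le> 2 ^ n"
      using assms(2)[of n] by (metis of_nat_le_iff of_nat_numeral of_nat_power)
    show "exp (-2) ^ Suc n \<le> (1 / 4 :: real) ^ Suc n"
      using exp2 by (intro power_mono) auto
  qed auto
  also have "\<dots> = (\<Sum>n\<le>m. (1 / 2) ^ Suc n)"
    by (intro sum.cong refl) (simp add: power_divide field_simps flip: power_mult_distrib)
  also have "\<dots> = 1 - (1 / 2) ^ Suc m"
    by (induction m) auto
  also have "\<dots> < (1::real)"
    by simp
  finally show ?thesis .
qed

section \<open>Discretization of the integral norms\<close>

lemma norm_le_unif_norm:
  assumes "compact \<Omega>" "continuous_on \<Omega> f" "x \<in> \<Omega>"
  shows "norm (f x) \<le> unif_norm \<Omega> f"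
  unfolding unif_norm_def
proof (rule cSUP_upper)
  show "bdd_above ((\<lambda>x. norm (f x)) ` \<Omega>)"
    using assms by (intro bounded_imp_bdd_above compact_imp_bounded compact_continuous_image)
      (auto intro: continuous_intros)
qed fact

text \<open>
  Used to absorb the distance from an arbitrary function to the finest net.
\<close>
lemma sum_sqrt_weights_ge:
  fixes e :: "nat \<Rightarrow> real"
  assumes e: "antimono e" "\<And>j. e j \<ge> 0"
  shows "sqrt (real m) * e m \<le> (\<Sum>j\<le>m. e j / sqrt (real j + 1))"
proof -
  have "sqrt (real m) * e m \<le> sqrt (real m + 1) * e m"
    using e by (intro mult_right_mono) auto
  also have "\<dots> = (\<Sum>j\<le>m. e m / sqrt (real m + 1))"
    by (simp add: real_div_sqrt[symmetric, of "real m + 1"] field_simps)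
  also have "\<dots> \<le> (\<Sum>j\<le>m. e j / sqrt (real j + 1))"
    using e(2) by (intro sum_mono frac_le) (auto intro: antimonoD[OF e(1)])
  finally show ?thesis .
qed

text \<open>
  The probabilistic and the deterministic part are combined here. The family to which
  \<open>simultaneous_sampling\<close> is applied consists of \<open>\<phi> f\<close> for the roots \<open>f \<in> Y 0\<close>, bounded by \<open>L M\<close>, and of
  the increments along the links from \<open>Y n\<close> to \<open>Y (n div 2)\<close>, bounded by \<open>L e (n div 2)\<close>.
\<close>
lemma sampling_points_for_nets:
  fixes W :: "('a::topological_space \<Rightarrow> 'b::real_normed_vector) set" and Y :: "nat \<Rightarrow> ('a \<Rightarrow> 'b) set"
  assumes \<Omega>: "compact \<Omega>" and \<mu>: "prob_space \<mu>" "sets \<mu> = sets (restrict_space borel \<Omega>)"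
    and "p \<ge> 1" "M > 0" "m \<ge> 1"
    and W: "\<And>f. f \<in> W \<Longrightarrow> continuous_on \<Omega> f" "\<And>f. f \<in> W \<Longrightarrow> unif_norm \<Omega> f \<le> M"
    and e: "antimono e" "\<And>n. e n > 0"
    and Y: "\<And>n. Y n \<subseteq> W" "\<And>n. finite (Y n)" "\<And>n. card (Y n) \<le> 2 ^ n"
      "\<And>n f. f \<in> W \<Longrightarrow> \<exists>g\<in>Y n. unif_norm \<Omega> (f - g) \<le> e n"
  defines "\<phi> \<equiv> \<lambda>f x. norm (f x) powr p"
  obtains \<xi> where "\<xi> \<in> {1..m} \<rightarrow> \<Omega>"
    "\<And>f. f \<in> W \<Longrightarrow> \<bar>sampling_error \<mu> m (\<phi> f) \<xi>\<bar> \<le>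
       p * M powr (p - 1) / sqrt m * (2 * M + 14 * (\<Sum>j\<le>m. e j / sqrt (real j + 1)))"
proof -
  interpret prob_space \<mu> by fact
  define L where "L = p * M powr (p - 1)"
  have "L > 0"
    using \<open>p \<ge> 1\<close> \<open>M > 0\<close> by (simp add: L_def)
  have space: "space \<mu> = \<Omega>"
    using sets_eq_imp_space_eq[OF \<mu>(2)] by (simp add: space_restrict_space)
  have le_M: "norm (f x) \<le> M" if "f \<in> W" "x \<in> \<Omega>" for f x
    using norm_le_unif_norm[OF \<Omega> W(1)] W(2) that by (meson order_trans)
  have meas: "\<phi> f \<in> borel_measurable \<mu>" if "f \<in> W" for f
  proof -
    have "(\<lambda>x. norm (f x)) \<in> borel_measurable (restrict_space borel \<Omega>)"
      using W(1)[OF that] by (intro borel_measurable_continuous_on_restrict continuous_intros)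
    then have "(\<lambda>x. norm (f x)) \<in> borel_measurable \<mu>"
      by (simp add: measurable_cong_sets[OF \<mu>(2) refl])
    then show ?thesis
      unfolding \<phi>_def by measurable
  qed
  have root_bound: "\<bar>\<phi> f x\<bar> \<le> L * M" if "f \<in> W" "x \<in> \<Omega>" for f x
    using powr_Lipschitz[of "norm (f x)" 0 M p] le_M[OF that] \<open>M > 0\<close> \<open>p \<ge> 1\<close>
    by (auto simp: \<phi>_def L_def intro: order_trans mult_left_mono)
  have Lipschitz: "\<bar>\<phi> f x - \<phi> g x\<bar> \<le> L * r"
    if "f \<in> W" "g \<in> W" "unif_norm \<Omega> (f - g) \<le> r" "x \<in> \<Omega>" for f g x r
  proof -
    have "\<bar>\<phi> f x - \<phi> g x\<bar> \<le> L * \<bar>norm (f x) - norm (g x)\<bar>"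
      unfolding \<phi>_def L_def using le_M that \<open>p \<ge> 1\<close> by (intro powr_Lipschitz) auto
    also have "\<bar>norm (f x) - norm (g x)\<bar> \<le> norm ((f - g) x)"
      by (simp add: norm_triangle_ineq3)
    also have "\<dots> \<le> unif_norm \<Omega> (f - g)"
      using that W(1) by (intro norm_le_unif_norm \<Omega>)
        (auto simp: fun_diff_def intro!: continuous_intros)
    finally show ?thesis
      using that \<open>L > 0\<close> by (auto intro: order_trans mult_left_mono)
  qed
  have int: "integrable \<mu> (\<phi> f)" if "f \<in> W" for f
    by (rule integrable_const_bound[where B = "L * M"])
       (use that meas root_bound space in auto)

  have "\<exists>g\<in>Y (n div 2). unif_norm \<Omega> (f - g) \<le> e (n div 2)" if "f \<in> Y n" for f n
    using Y(1,4) that by blast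
  then have ex: "\<exists>g. g \<in> Y (n div 2) \<and> unif_norm \<Omega> (f - g) \<le> e (n div 2)" if "f \<in> Y n" for f n
    using that by blast
  define parent where
    "parent n f = (SOME g. g \<in> Y (n div 2) \<and> unif_norm \<Omega> (f - g) \<le> e (n div 2))" for n f
  have parent: "parent n f \<in> Y (n div 2)" "unif_norm \<Omega> (f - parent n f) \<le> e (n div 2)"
    if "f \<in> Y n" for n f
    using someI_ex[OF ex[OF that]] by (simp_all add: parent_def)
  define h where "h = (\<lambda>(n, f) x. if n = 0 then \<phi> f x else \<phi> f x - \<phi> (parent n f) x)"
  define \<delta> where "\<delta> = (\<lambda>(n::nat, f::'a \<Rightarrow> 'b). if n = 0 then L * M else L * e (n div 2))"
  define s where "s = (\<lambda>(n::nat, f::'a \<Rightarrow> 'b). 2 * sqrt (real n + 1))"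
  let ?I = "Sigma {..m} Y"
  have inW: "f \<in> W" "n \<noteq> 0 \<Longrightarrow> parent n f \<in> W" if "f \<in> Y n" for n f
    using that parent(1) Y(1) by blast+
  obtain \<xi> where \<xi>: "\<xi> \<in> {1..m} \<rightarrow> space \<mu>"
    and err: "\<And>i. i \<in> ?I \<Longrightarrow> \<bar>sampling_error \<mu> m (h i) \<xi>\<bar> \<le> s i * \<delta> i / sqrt m"
  proof (rule simultaneous_sampling)
    show "prob_space \<mu>" "finite ?I" "m \<ge> 1"
      using Y(2) \<open>m \<ge> 1\<close> prob_space_axioms by auto
    show "h i \<in> borel_measurable \<mu>" if "i \<in> ?I" for i
      using that meas inW by (cases i; cases "fst i = 0") (auto simp: h_def intro!: borel_measurable_diff)
    show "\<bar>h i x\<bar> \<le> \<delta> i" if "i \<in> ?I" "x \<in> space \<mu>" for i x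
      using that inW root_bound Lipschitz parent(2) space by (cases i) (auto simp: h_def \<delta>_def)
    show "\<delta> i > 0" if "i \<in> ?I" for i
      using \<open>L > 0\<close> \<open>M > 0\<close> e(2) by (cases i) (auto simp: \<delta>_def)
    show "s i \<ge> 0" if "i \<in> ?I" for i
      by (cases i) (auto simp: s_def)
    show "(\<Sum>i\<in>?I. 2 * exp (- (s i)\<^sup>2 / 2)) < 1"
      using link_failure_probability_less_1[of Y m] Y(2,3) by (simp add: s_def case_prod_unfold)
  qed (rule that, assumption+)
  define E where "E f = sampling_error \<mu> m (\<phi> f) \<xi>" for f
  define S where "S k = (\<Sum>j\<le>k. e j / sqrt (real j + 1))" for k :: nat
  have e0: "e j \<ge> 0" for j
    using e(2)[of j] by simp
  have chain: "\<bar>E g\<bar> \<le> 2 * L / sqrt m * (M + 6 * S (m div 2))" if "g \<in> Y m" for g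
    unfolding S_def
  proof (rule chaining[where m = m and Y = Y])
    show "2 * L / sqrt m \<ge> 0"
      using \<open>L > 0\<close> by simp
    show "\<bar>E f\<bar> \<le> 2 * L / sqrt m * M" if "f \<in> Y 0" for f
      using err[of "(0, f)"] that by (simp add: h_def \<delta>_def s_def E_def mult_ac)
    show "\<exists>g\<in>Y (n div 2). \<bar>E f - E g\<bar> \<le> 2 * L / sqrt m * (sqrt (real n + 1) * e (n div 2))"
      if n: "1 \<le> n" "n \<le> m" "f \<in> Y n" for n f
    proof (intro bexI)
      have "E f - E (parent n f) = sampling_error \<mu> m (h (n, f)) \<xi>"
        using n int inW by (simp add: E_def h_def sampling_error_diff)
      with err[of "(n, f)"] n show "\<bar>E f - E (parent n f)\<bar> \<le> 2 * L / sqrt m * (sqrt (real n + 1) * e (n div 2))"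
        by (simp add: \<delta>_def s_def mult_ac)
    qed (use parent n in auto)
  qed (use e e0 that in auto)
  have "\<bar>E f\<bar> \<le> L / sqrt m * (2 * M + 14 * S m)" if "f \<in> W" for f
  proof -
    from Y(4)[OF that, of m] obtain g where g: "g \<in> Y m" "unif_norm \<Omega> (f - g) \<le> e m"
      by blast
    have "E f - E g = sampling_error \<mu> m (\<lambda>x. \<phi> f x - \<phi> g x) \<xi>"
      using int[OF that] int[of g] g inW(1) by (simp add: E_def sampling_error_diff)
    also have "\<bar>\<dots>\<bar> \<le> 2 * (L * e m)"
      using \<xi> that g Y(1) meas Lipschitz space \<open>m \<ge> 1\<close>
      by (intro abs_sampling_error_le prob_space_axioms borel_measurable_diff) blast+
    also have "\<dots> \<le> 2 * (L * (S m / sqrt m))"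
      using sum_sqrt_weights_ge[OF e(1) e0, of m] \<open>L > 0\<close> \<open>m \<ge> 1\<close>
      by (intro mult_left_mono) (auto simp: S_def field_simps)
    finally have "\<bar>E f\<bar> \<le> 2 * L / sqrt m * (M + 6 * S (m div 2)) + 2 * (L * (S m / sqrt m))"
      using chain[OF g(1)] by linarith
    also have "\<dots> \<le> 2 * L / sqrt m * (M + 6 * S m) + 2 * (L * (S m / sqrt m))"
      unfolding S_def using \<open>L > 0\<close> e0
      by (intro add_right_mono mult_left_mono add_left_mono sum_mono2) auto
    also have "\<dots> = L / sqrt m * (2 * M + 14 * S m)"
      by (simp add: algebra_simps add_divide_distrib)
    finally show ?thesis .
  qed
  with \<xi> show ?thesis
    by (intro that[of \<xi>]) (auto simp: space E_def L_def S_def)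
qed

text \<open>
  Nets with radius exactly \<open>\<epsilon>\<^sub>n(W)\<close> may not exist, and \<open>\<epsilon>\<^sub>n(W)\<close> may be \<open>0\<close>. The radii are therefore
  enlarged by \<open>\<eta> = M / (m + 1)\<close>, which adds at most \<open>(m + 1) \<eta> = M\<close> to the weighted sum. The
  enlargement of the radii turns \<open>2 M + 14 S\<close> into \<open>16 M + 14 S\<close>, whence the constant 16.
\<close>
lemma discretization_number_le:
  fixes W :: "('a::topological_space \<Rightarrow> 'b::real_normed_vector) set"
  assumes \<Omega>: "compact \<Omega>" and \<mu>: "prob_space \<mu>" "sets \<mu> = sets (restrict_space borel \<Omega>)"
    and "p \<ge> 1" "M > 0" "m \<ge> 1"
    and W: "\<forall>f\<in>W. continuous_on \<Omega> f \<and> unif_norm \<Omega> f \<le> M"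
  shows "discretization_number \<Omega> \<mu> m W p \<le>
           ennreal (16 * p * real m powr (- 1 / 2) * M powr (p - 1)) *
           (ennreal M + (\<Sum>n=0..m. ennreal (real (n + 1) powr (- 1 / 2)) *
                              entropy_number (unif_norm \<Omega>) n W))"
proof -
  interpret prob_space \<mu> by fact
  have "\<Omega> \<noteq> {}"
    using not_empty sets_eq_imp_space_eq[OF \<mu>(2)] by (simp add: space_restrict_space)
  then obtain x0 where "x0 \<in> \<Omega>"
    by blast
  show ?thesis
  proof (cases "W = {}")
    case True
    have "discretization_number \<Omega> \<mu> m W p \<le> 0"
      unfolding discretization_number_def True using \<open>x0 \<in> \<Omega>\<close>
      by (intro INF_lower2[of "\<lambda>_. x0"]) (auto simp: bot_ennreal)
    then show ?thesis
      by simp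
  next
    case False
    then obtain f0 where f0: "f0 \<in> W"
      by blast
    let ?\<epsilon> = "\<lambda>n. entropy_number (unif_norm \<Omega>) n W"
    have dist_le: "unif_norm \<Omega> (f - g) \<le> 2 * M" if "f \<in> W" "g \<in> W" for f g
      unfolding unif_norm_def
    proof (rule cSUP_least)
      fix x assume "x \<in> \<Omega>"
      then have "norm (f x) \<le> M" "norm (g x) \<le> M"
        using norm_le_unif_norm[OF \<Omega>] W that by (meson order_trans)+
      then show "norm ((f - g) x) \<le> 2 * M"
        using norm_triangle_ineq4[of "f x" "g x"] by simp
    qed fact
    have fin: "?\<epsilon> n < top" for n
    proof -
      have "?\<epsilon> n \<le> ennreal (2 * M)"
        using f0 dist_le \<open>M > 0\<close> by (intro entropy_number_le) auto
      then show ?thesis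
        using ennreal_less_top le_less_trans by blast
    qed
    define \<eta> where "\<eta> = M / (real m + 1)"
    have "\<eta> > 0"
      using \<open>M > 0\<close> by (simp add: \<eta>_def)
    define e where "e n = enn2real (?\<epsilon> n) + \<eta>" for n
    have \<epsilon>_less: "?\<epsilon> n < ennreal (e n)" for n
      using fin[of n] \<open>\<eta> > 0\<close> by (cases "?\<epsilon> n") (auto simp: e_def ennreal_less_iff)
    have e_anti: "antimono e"
      unfolding e_def using antimonoD[OF antimono_entropy_number] fin
      by (intro antimonoI add_right_mono enn2real_mono) auto
    have e_pos: "e n > 0" for n
      using \<open>\<eta> > 0\<close> by (simp add: e_def add_nonneg_pos)
    have "\<exists>Y. Y \<subseteq> W \<and> finite Y \<and> card Y \<le> 2 ^ n \<and> (\<forall>f\<in>W. \<exists>g\<in>Y. unif_norm \<Omega> (f - g) \<le> e n)" for n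
      by (rule entropy_number_net[OF \<epsilon>_less[of n]]) blast
    then obtain Y where Y: "\<And>n. Y n \<subseteq> W" "\<And>n. finite (Y n)" "\<And>n. card (Y n) \<le> 2 ^ n"
      "\<And>n f. f \<in> W \<Longrightarrow> \<exists>g\<in>Y n. unif_norm \<Omega> (f - g) \<le> e n"
      by metis
    define S where "S = (\<Sum>j\<le>m. enn2real (?\<epsilon> j) / sqrt (real j + 1))"
    have "S \<ge> 0"
      unfolding S_def by (intro sum_nonneg) auto
    have S_le: "(\<Sum>j\<le>m. e j / sqrt (real j + 1)) \<le> S + M"
    proof -
      have "(\<Sum>j\<le>m. e j / sqrt (real j + 1)) = S + (\<Sum>j\<le>m. \<eta> / sqrt (real j + 1))"
        by (simp add: S_def e_def add_divide_distrib sum.distrib)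
      also have "(\<Sum>j\<le>m. \<eta> / sqrt (real j + 1)) \<le> (\<Sum>j\<le>m. \<eta> / 1)"
        using \<open>\<eta> > 0\<close> by (intro sum_mono divide_left_mono) auto
      also have "\<dots> = M"
        by (simp add: \<eta>_def field_simps)
      finally show ?thesis
        by simp
    qed
    obtain \<xi> where \<xi>: "\<xi> \<in> {1..m} \<rightarrow> \<Omega>"
      and err: "\<And>f. f \<in> W \<Longrightarrow> \<bar>sampling_error \<mu> m (\<lambda>x. norm (f x) powr p) \<xi>\<bar> \<le>
        p * M powr (p - 1) / sqrt m * (2 * M + 14 * (\<Sum>j\<le>m. e j / sqrt (real j + 1)))"
    proof (rule sampling_points_for_nets[OF \<Omega> \<mu> \<open>p \<ge> 1\<close> \<open>M > 0\<close> \<open>m \<ge> 1\<close> _ _ e_anti e_pos Y])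
      show "continuous_on \<Omega> f" "unif_norm \<Omega> f \<le> M" if "f \<in> W" for f
        using W that by auto
    qed (assumption | rule that, assumption+)+
    have inv_sqrt: "x powr (- 1 / 2) = 1 / sqrt x" if "x > 0" for x :: real
      using that powr_minus[of x "1 / 2"] by (simp add: powr_half_sqrt inverse_eq_divide)
    let ?c = "16 * p * real m powr (- 1 / 2) * M powr (p - 1)"
    have "\<bar>Lp_norm_pow \<mu> p f - 1 / real m * (\<Sum>j=1..m. norm (f (\<xi> j)) powr p)\<bar> \<le> ?c * (M + S)"
      if "f \<in> W" for f
    proof -
      have "2 * M + 14 * (\<Sum>j\<le>m. e j / sqrt (real j + 1)) \<le> 16 * (M + S)"
        using S_le \<open>S \<ge> 0\<close> by (simp add: algebra_simps)
      then have "p * M powr (p - 1) / sqrt m * (2 * M + 14 * (\<Sum>j\<le>m. e j / sqrt (real j + 1)))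
          \<le> p * M powr (p - 1) / sqrt m * (16 * (M + S))"
        using \<open>p \<ge> 1\<close> by (intro mult_left_mono) auto
      also have "\<dots> = ?c * (M + S)"
        using \<open>m \<ge> 1\<close> by (subst inv_sqrt) (simp_all add: algebra_simps add_divide_distrib)
      finally show ?thesis
        using err[OF that] by (simp add: sampling_error_def Lp_norm_pow_def)
    qed
    then have "discretization_number \<Omega> \<mu> m W p \<le> ennreal (?c * (M + S))"
      unfolding discretization_number_def
      by (intro INF_lower2[OF \<xi>] SUP_least ennreal_leI)
    also have "\<dots> = ennreal ?c * (ennreal M + ennreal S)"
      using \<open>p \<ge> 1\<close> \<open>M > 0\<close> \<open>S \<ge> 0\<close> by (simp add: ennreal_mult ennreal_plus)
    also have "ennreal S = (\<Sum>n=0..m. ennreal (real (n + 1) powr (- 1 / 2)) * ?\<epsilon> n)"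
    proof -
      have "ennreal S = (\<Sum>j\<le>m. ennreal (enn2real (?\<epsilon> j) / sqrt (real j + 1)))"
        unfolding S_def by (subst sum_ennreal) auto
      also have "\<dots> = (\<Sum>n=0..m. ennreal (real (n + 1) powr (- 1 / 2)) * ?\<epsilon> n)"
      proof (intro sum.cong)
        fix n
        have "ennreal (enn2real (?\<epsilon> n) / sqrt (real n + 1)) =
            ennreal (1 / sqrt (real n + 1)) * ennreal (enn2real (?\<epsilon> n))"
          by (subst ennreal_mult[symmetric]) auto
        then show "ennreal (enn2real (?\<epsilon> n) / sqrt (real n + 1)) =
            ennreal (real (n + 1) powr (- 1 / 2)) * ?\<epsilon> n"
          using fin[of n] inv_sqrt[of "real (n + 1)"] by (simp add: add.commute)
      qed auto
      finally show ?thesis .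
    qed
    finally show ?thesis .
  qed
qed

lemma compactin_Euclidean_space_imp_compact:
  assumes "compactin (Euclidean_space d) \<Omega>"
  shows "compact \<Omega>"
  using assms by (simp add: Euclidean_space_def compactin_subtopology euclidean_product_topology)

theorem theorem1p3:
  "\<exists>C::real. C > 0 \<and>
     (\<forall>(d::nat) (\<Omega> :: (nat \<Rightarrow> real) set) (\<mu> :: (nat \<Rightarrow> real) measure) (p::real) (M::real).
        compactin (Euclidean_space d) \<Omega> \<longrightarrow>
        prob_space \<mu> \<longrightarrow> sets \<mu> = sets (restrict_space borel \<Omega>) \<longrightarrow>
        p \<ge> 1 \<longrightarrow> M > 0 \<longrightarrow>
        (\<forall>W :: ((nat \<Rightarrow> real) \<Rightarrow> real) set.
           (\<forall>f\<in>W. continuous_on \<Omega> f \<and> unif_norm \<Omega> f \<le> M) \<longrightarrow>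
           (\<forall>m\<ge>1. discretization_number \<Omega> \<mu> m W p \<le>
              ennreal (C * p * real m powr (- 1 / 2) * M powr (p - 1)) *
              (ennreal M + (\<Sum>n=0..m. ennreal (real (n + 1) powr (- 1 / 2)) *
                                 entropy_number (unif_norm \<Omega>) n W)))) \<and>
        (\<forall>W :: ((nat \<Rightarrow> real) \<Rightarrow> complex) set.
           (\<forall>f\<in>W. continuous_on \<Omega> f \<and> unif_norm \<Omega> f \<le> M) \<longrightarrow>
           (\<forall>m\<ge>1. discretization_number \<Omega> \<mu> m W p \<le>
              ennreal (C * p * real m powr (- 1 / 2) * M powr (p - 1)) *
              (ennreal M + (\<Sum>n=0..m. ennreal (real (n + 1) powr (- 1 / 2)) *
                                 entropy_number (unif_norm \<Omega>) n W)))))"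
  by (intro exI[of _ 16] conjI allI impI discretization_number_le compactin_Euclidean_space_imp_compact)
     simp_all

end
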